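(* Let $K$ be a compact countable subset of $\mathbb{R}$ with Cantor-Bendixson characteristic $\mathcal{CB}(K)=(\alpha,p)\in\Omega\times\omega$. Then $p=0$ if and only if $K=\varnothing$.
   Context: A countable set is one that is either finite (possibly empty) or countably infinite; $\omega$ is the set of natural numbers (including $0$) and $\Omega$ is the set of all countable ordinals. For $A\subset\mathbb{R}$, $A'$ denotes the derived set (set of all limit points) of $A$, and the Cantor-Bendixson derivatives are defined by transfinite recursion: $A^{(0)}=A$; $A^{(\beta+1)}=(A^{(\beta)})'$ for every ordinal $\beta$; $A^{(\lambda)}=\bigcap_{\gamma<\lambda}A^{(\gamma)}$ for every limit ordinal $\lambda\neq 0$. For every compact countable $K\subset\mathbb{R}$ there is a countable ordinal $\beta$ with $K^{(\beta)}$ finite (a theorem of Cantor). The Cantor-Bendixson characteristic of such a $K$ is the pair $\mathcal{CB}(K)=(\alpha,p)\in\Omega\times\omega$, where $\alpha$ is the smallest countable ordinal such that $K^{(\alpha)}$ is finite and $p=|K^{(\alpha)}|$. *)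

theory Defs
  imports "HOL-Analysis.Analysis" "HOL-Library.Countable_Set_Type"
begin

unbundle cardinal_syntax

text \<open>
  The set \<open>\<Omega>\<close> of countable ordinals is the first uncountable ordinal, i.e. the (well-ordered)
  cardinal successor of \<open>natLeq\<close>, the order of the natural numbers. Up to isomorphism it is the
  only well-order that is uncountable but has countable proper initial segments; both properties
  are proved below.
\<close>

typedef countable_ordinal = "Field (cardSuc natLeq)"
  using Field_cardSuc_not_empty natLeq_Card_order by blast

lemma Well_order_cardSuc_natLeq: "Well_order (cardSuc natLeq)"
  using cardSuc_Card_order[OF natLeq_Card_order] by (simp add: card_order_on_def)

instantiation countable_ordinal :: ord
begin

definition less_eq_countable_ordinal :: "countable_ordinal \<Rightarrow> countable_ordinal \<Rightarrow> bool" where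
  "a \<le> b \<longleftrightarrow> (Rep_countable_ordinal a, Rep_countable_ordinal b) \<in> cardSuc natLeq"

definition less_countable_ordinal :: "countable_ordinal \<Rightarrow> countable_ordinal \<Rightarrow> bool" where
  "a < b \<longleftrightarrow> a \<le> b \<and> a \<noteq> (b :: countable_ordinal)"

instance ..

end

instance countable_ordinal :: wellorder
proof -
  let ?r = "cardSuc natLeq"
  have wo: "Well_order ?r" by (rule Well_order_cardSuc_natLeq)
  have refl: "refl_on (Field ?r) ?r" and trans: "trans ?r" and antisym: "antisym ?r"
    and total: "total_on (Field ?r) ?r" and wf: "wf (?r - Id)"
    using wo by (auto simp: well_order_on_def linear_order_on_def partial_order_on_def
        preorder_on_def)
  have le_refl: "x \<le> x" for x :: countable_ordinal
    unfolding less_eq_countable_ordinal_def using refl Rep_countable_ordinal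
    by (auto simp: refl_on_def)
  have le_antisym: "x = y" if "x \<le> y" "y \<le> x" for x y :: countable_ordinal
    using that antisym unfolding less_eq_countable_ordinal_def
    by (metis antisymD Rep_countable_ordinal_inject)
  have le_trans: "x \<le> z" if "x \<le> y" "y \<le> z" for x y z :: countable_ordinal
    using that trans unfolding less_eq_countable_ordinal_def by (metis transD)
  have le_total: "x \<le> y \<or> y \<le> x" for x y :: countable_ordinal
    using le_refl[of x] total Rep_countable_ordinal[of x] Rep_countable_ordinal[of y]
    unfolding less_eq_countable_ordinal_def
    by (metis total_on_def)
  have wf': "wf {(x, y). x < (y :: countable_ordinal)}"
    by (rule wf_subset[OF wf_inv_image[OF wf, of Rep_countable_ordinal]])
       (auto simp: less_countable_ordinal_def less_eq_countable_ordinal_def inv_image_def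
          Rep_countable_ordinal_inject)
  show "OFCLASS(countable_ordinal, wellorder_class)"
  proof (intro_classes)
    fix P :: "countable_ordinal \<Rightarrow> bool" and a
    assume "\<And>x. (\<And>y. y < x \<Longrightarrow> P y) \<Longrightarrow> P x"
    then show "P a"
      using wf_induct_rule[OF wf', of P a] by blast
  qed (use le_refl le_antisym le_trans le_total in \<open>auto simp: less_countable_ordinal_def\<close>)
qed

lemma uncountable_countable_ordinals: "uncountable (UNIV :: countable_ordinal set)"
proof
  assume "countable (UNIV :: countable_ordinal set)"
  then have "countable (range Rep_countable_ordinal)" by simp
  then have "countable (Field (cardSuc natLeq))"
    by (simp add: type_definition.Rep_range[OF type_definition_countable_ordinal])
  then have "|Field (cardSuc natLeq)| \<le>o natLeq"
    by (simp add: countable_card_le_natLeq)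
  then have "cardSuc natLeq \<le>o natLeq"
    using card_of_Field_ordIso[OF cardSuc_Card_order[OF natLeq_Card_order]]
      ordIso_ordLeq_trans ordIso_symmetric by blast
  then show False
    using cardSuc_greater[OF natLeq_Card_order] not_ordLess_ordLeq by blast
qed

lemma countable_below_countable_ordinal: "countable {..< a :: countable_ordinal}"
proof -
  have "|underS (cardSuc natLeq) (Rep_countable_ordinal a)| <o cardSuc natLeq"
    using card_of_underS[OF cardSuc_Card_order[OF natLeq_Card_order] Rep_countable_ordinal] .
  then have "|underS (cardSuc natLeq) (Rep_countable_ordinal a)| \<le>o natLeq"
    using cardSuc_ordLeq_ordLess natLeq_Card_order card_of_Card_order by blast
  then have "countable (underS (cardSuc natLeq) (Rep_countable_ordinal a))"
    by (simp add: countable_card_le_natLeq)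
  moreover have "Rep_countable_ordinal ` {..<a} \<subseteq>
      underS (cardSuc natLeq) (Rep_countable_ordinal a)"
    by (auto simp: underS_def less_countable_ordinal_def less_eq_countable_ordinal_def
        Rep_countable_ordinal_inject)
  ultimately have "countable (Rep_countable_ordinal ` {..<a})"
    using countable_subset by blast
  then show ?thesis
    using countable_image_inj_on inj_on_subset[of Rep_countable_ordinal UNIV]
    by (metis Rep_countable_ordinal_inject injI subset_UNIV)
qed

unbundle no cardinal_syntax

instantiation countable_ordinal :: zero
begin

definition zero_countable_ordinal :: countable_ordinal where
  "0 = (LEAST a :: countable_ordinal. True)"

instance ..

end

definition ord_succ :: "countable_ordinal \<Rightarrow> countable_ordinal" where
  "ord_succ a = (LEAST b. a < b)"

definition is_limit_ordinal :: "countable_ordinal \<Rightarrow> bool" where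
  "is_limit_ordinal a \<longleftrightarrow> a \<noteq> 0 \<and> (\<forall>b. a \<noteq> ord_succ b)"

lemma zero_le_countable_ordinal: "0 \<le> (a :: countable_ordinal)"
  unfolding zero_countable_ordinal_def by (rule Least_le) simp

lemma less_ord_succ: "a < ord_succ a"
proof -
  have "\<exists>b. a < b"
  proof (rule ccontr)
    assume "\<nexists>b. a < b"
    then have "UNIV = insert a {..<a}" by (metis insertI1 insertI2 lessThan_iff linorder_less_linear subsetI subset_UNIV subset_antisym)
    then show False
      using uncountable_countable_ordinals countable_below_countable_ordinal[of a]
      by (metis countable_insert)
  qed
  then show ?thesis unfolding ord_succ_def by (rule LeastI_ex)
qed

lemma ord_succ_le_iff: "ord_succ a \<le> b \<longleftrightarrow> a < b"
  using less_ord_succ[of a] Least_le[of "\<lambda>b. a < b" b] unfolding ord_succ_def by auto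

lemma ord_succ_inject: "ord_succ a = ord_succ b \<longleftrightarrow> a = b"
  by (metis less_ord_succ ord_succ_le_iff not_less not_less_iff_gr_or_eq)

lemma ord_succ_neq_zero: "ord_succ a \<noteq> 0"
  by (metis less_ord_succ zero_le_countable_ordinal not_less)

definition derived_set :: "real set \<Rightarrow> real set" where
  "derived_set A = {x. x islimpt A}"

function cb_derivative :: "real set \<Rightarrow> countable_ordinal \<Rightarrow> real set" where
  "cb_derivative A a =
     (if a = 0 then A
      else if \<exists>b. a = ord_succ b then derived_set (cb_derivative A (THE b. a = ord_succ b))
      else (\<Inter>g\<in>{..<a}. cb_derivative A g))"
  by pat_completeness auto
termination
proof (relation "{((A, a), (B, b)). a < b}")
  show "wf {((A :: real set, a :: countable_ordinal), (B :: real set, b)). a < b}"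
    by (rule wf_subset[OF wf_inv_image[OF wf, of snd]]) (auto simp: inv_image_def)
qed (auto simp: ord_succ_inject less_ord_succ)

declare cb_derivative.simps [simp del]

lemma cb_derivative_zero: "cb_derivative A 0 = A"
  by (simp add: cb_derivative.simps)

lemma cb_derivative_succ: "cb_derivative A (ord_succ b) = derived_set (cb_derivative A b)"
  by (subst cb_derivative.simps) (simp add: ord_succ_neq_zero ord_succ_inject)

lemma cb_derivative_limit:
  "is_limit_ordinal a \<Longrightarrow> cb_derivative A a = (\<Inter>g\<in>{..<a}. cb_derivative A g)"
  by (subst cb_derivative.simps) (simp add: is_limit_ordinal_def)

text \<open>
  For compact countable \<open>K\<close> the minimum exists by a theorem of Cantor, so \<open>LEAST\<close> denotes a
  genuine minimum; see \<open>finite_cb_derivative\<close> below.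
\<close>

definition cb_rank :: "real set \<Rightarrow> countable_ordinal" where
  "cb_rank K = (LEAST a. finite (cb_derivative K a))"

definition CB :: "real set \<Rightarrow> countable_ordinal \<times> nat" where
  "CB K = (cb_rank K, card (cb_derivative K (cb_rank K)))"

lemma closed_cb_derivative: "closed K \<Longrightarrow> closed (cb_derivative K a)"
proof (induction a rule: less_induct)
  case (less a)
  consider "a = 0" | b where "a = ord_succ b" | "is_limit_ordinal a"
    by (auto simp: is_limit_ordinal_def)
  then show ?case
  proof cases
    case 2
    then show ?thesis
      by (simp add: cb_derivative_succ derived_set_def closed_limpts)
  qed (use less in \<open>auto simp: cb_derivative_zero cb_derivative_limit\<close>)
qed

lemma cb_derivative_antimono:
  assumes "closed K" "a \<le> b"
  shows "cb_derivative K b \<subseteq> cb_derivative K a"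
  using assms(2)
proof (induction b rule: less_induct)
  case (less b)
  consider "b = a" | "a < b" "b = 0" | c where "a < b" "b = ord_succ c" | "a < b" "is_limit_ordinal b"
    using less.prems unfolding is_limit_ordinal_def by (metis order_le_less)
  then show ?case
  proof cases
    case 2
    then show ?thesis using zero_le_countable_ordinal[of a] by simp
  next
    case 3
    then have "c < b" "a \<le> c"
      using less_ord_succ[of c] ord_succ_le_iff[of c a] by auto
    moreover have "cb_derivative K b \<subseteq> cb_derivative K c"
      using closed_cb_derivative[OF assms(1), of c] 3
      by (auto simp: cb_derivative_succ derived_set_def closed_limpt)
    ultimately show ?thesis using less.IH by blast
  qed (auto simp: cb_derivative_limit)
qed

lemma countable_closed_has_isolated_point:
  fixes S :: "real set"
  assumes "closed S" "countable S" "S \<noteq> {}"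
  shows "\<exists>x\<in>S. \<not> x islimpt S"
proof (rule ccontr)
  assume "\<not> (\<exists>x\<in>S. \<not> x islimpt S)"
  then have lim: "x islimpt S" if "x \<in> S" for x using that by blast
  let ?G = "(\<lambda>x. S - {x}) ` S"
  have "S \<subseteq> closure (\<Inter>?G)"
  proof (rule Baire[OF assms(1)])
    show "countable ?G" using assms(2) by simp
    fix T assume "T \<in> ?G"
    then obtain x where x: "x \<in> S" "T = S - {x}" by blast
    have "openin (top_of_set S) T"
      using x by (metis Diff_eq inf_commute openin_open_Int open_delete open_UNIV Compl_eq_Diff_UNIV)
    moreover have "S \<subseteq> closure T"
    proof
      fix y assume "y \<in> S"
      then have "y islimpt S" by (rule lim)
      then have "y islimpt T" using x(2) 
        by (metis islimpt_insert insert_Diff_single islimpt_subset subset_insertI insert_absorb x(1))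
      then show "y \<in> closure T" by (simp add: closure_def)
    qed
    ultimately show "openin (top_of_set S) T \<and> S \<subseteq> closure T" ..
  qed
  moreover have "\<Inter>?G = {}" using assms(3) by blast
  ultimately show False using assms(3) by simp
qed

lemma finite_cb_derivative:
  fixes K :: "real set"
  assumes "compact K" "countable K"
  shows "\<exists>a. finite (cb_derivative K a)"
proof (rule ccontr)
  assume inf: "\<nexists>a. finite (cb_derivative K a)"
  let ?D = "cb_derivative K"
  have cl: "closed K" using assms(1) by (rule compact_imp_closed)
  have sub: "?D a \<subseteq> K" for a
    using cb_derivative_antimono[OF cl zero_le_countable_ordinal[of a]]
    by (simp add: cb_derivative_zero)
  have "\<exists>x. x \<in> ?D a \<and> x \<notin> ?D (ord_succ a)" for a
  proof -
    have "countable (?D a)" using sub assms(2) countable_subset by blast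
    moreover have "?D a \<noteq> {}" using inf by (metis finite.emptyI)
    ultimately show ?thesis
      using countable_closed_has_isolated_point[OF closed_cb_derivative[OF cl]]
      by (auto simp: cb_derivative_succ derived_set_def)
  qed
  then obtain f where f: "\<And>a. f a \<in> ?D a" "\<And>a. f a \<notin> ?D (ord_succ a)" by metis
  have neq: "f a \<noteq> f b" if "a < b" for a b
    using that f(1)[of b] f(2)[of a] cb_derivative_antimono[OF cl, of "ord_succ a" b]
    by (auto simp: ord_succ_le_iff)
  then have "inj f" by (metis injI not_less_iff_gr_or_eq)
  moreover have "countable (range f)"
    using sub f(1) assms(2) by (meson countable_subset image_subsetI subsetD)
  ultimately show False
    using uncountable_countable_ordinals countable_image_inj_on by blast
qed

end

theory Submission
  imports Defs
begin

text \<open>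
  Every derivative before the rank is infinite and compact. The derivative at the rank is
  therefore nonempty: at a successor by Bolzano--Weierstrass, at a limit by Cantor's
  intersection theorem for chains of nonempty compact sets.
\<close>

lemma cb_derivative_subset:
  assumes "closed K"
  shows "cb_derivative K a \<subseteq> K"
  using cb_derivative_antimono[OF assms zero_le_countable_ordinal, of a]
  by (simp add: cb_derivative_zero)

lemma compact_cb_derivative:
  assumes "compact K"
  shows "compact (cb_derivative K a)"
proof -
  have "closed K" using assms by (rule compact_imp_closed)
  then show ?thesis
    using compact_Int_closed[OF assms closed_cb_derivative, of K a] cb_derivative_subset[of K a]
    by (simp add: Int_absorb1)
qed

text \<open>The hypothesis \<open>inf\<close> asks for infinite rather than merely nonempty earlier
  derivatives because a nonempty finite set has empty derived set.\<close>

lemma cb_derivative_nonempty: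
  assumes "compact K" "K \<noteq> {}" and inf: "\<And>b. b < a \<Longrightarrow> infinite (cb_derivative K b)"
  shows "cb_derivative K a \<noteq> {}"
proof -
  consider "a = 0" | b where "a = ord_succ b" | "is_limit_ordinal a"
    by (auto simp: is_limit_ordinal_def)
  then show ?thesis
  proof cases
    case 1
    then show ?thesis using assms(2) by (simp add: cb_derivative_zero)
  next
    case 2
    then have "infinite (cb_derivative K b)" using inf less_ord_succ by blast
    \<comment> \<open>Bolzano--Weierstrass is applied to the compact set as an infinite subset of
      itself.\<close>
    then obtain x where "x islimpt cb_derivative K b"
      using compact_cb_derivative[OF assms(1), of b]
      by (auto simp: compact_eq_Bolzano_Weierstrass)
    then show ?thesis using 2 by (auto simp: cb_derivative_succ derived_set_def)
  next
    case 3
    have "\<Inter>(cb_derivative K ` {..<a}) \<noteq> {}"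
    proof (rule compact_chain)
      show "compact S" if "S \<in> cb_derivative K ` {..<a}" for S
        using that compact_cb_derivative[OF assms(1)] by blast
      show "{} \<notin> cb_derivative K ` {..<a}"
        using inf by force
      show "S \<subseteq> T \<or> T \<subseteq> S"
        if ST: "S \<in> cb_derivative K ` {..<a} \<and> T \<in> cb_derivative K ` {..<a}" for S T
      proof -
        obtain b c where "S = cb_derivative K b" "T = cb_derivative K c" using ST by blast
        then show ?thesis
          using cb_derivative_antimono[OF compact_imp_closed[OF assms(1)]] linear[of b c] by metis
      qed
    qed
    then show ?thesis using 3 by (simp add: cb_derivative_limit)
  qed
qed

theorem proposition3p1:
  fixes K :: "real set" and \<alpha> :: countable_ordinal and p :: nat
  assumes "compact K" and "countable K" and "CB K = (\<alpha>, p)"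
  shows "p = 0 \<longleftrightarrow> K = {}"
proof -
  have rank: "\<alpha> = (LEAST a. finite (cb_derivative K a))" and p: "p = card (cb_derivative K \<alpha>)"
    using assms(3) by (auto simp: CB_def cb_rank_def)
  \<comment> \<open>Since \<open>card\<close> is 0 on infinite sets too, finiteness is what lets
    \<open>p = 0\<close> mean emptiness. It comes from Cantor's theorem, by which the minimum is
    attained.\<close>
  have "finite (cb_derivative K \<alpha>)"
    unfolding rank by (rule LeastI_ex[OF finite_cb_derivative[OF assms(1,2)]])
  then have "p = 0 \<longleftrightarrow> cb_derivative K \<alpha> = {}"
    by (simp add: p)
  moreover have "infinite (cb_derivative K b)" if "b < \<alpha>" for b
    using not_less_Least[OF that[unfolded rank]] .
  \<comment> \<open>For \<open>K\<close> nonempty, minimality of the rank supplies the hypothesis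
    \<open>inf\<close>; for \<open>K\<close> empty, the derivative is a subset of the empty
    set.\<close>
  ultimately show ?thesis
    using cb_derivative_nonempty[OF assms(1), of \<alpha>]
      cb_derivative_subset[OF compact_imp_closed[OF assms(1)], of \<alpha>] by auto
qed

end
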